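(* Let $n\geq 1$ be an integer. The set $L_n=\{x_P\in\{0,1\}^{\omega^n}\mid P\in I_{\omega^n}\}$ is a regular $\omega^n$-language, i.e. it is the set of words of length $\omega^n$ accepted by some $\omega^n$-automaton.
   Context: For $P\subseteq\omega^n$, $x_P$ is the $\omega^n$-word over $\{0,1\}$ with $x_P(\alpha)=1$ iff $\alpha\in P$. $I_{\omega^n}=\{P\subseteq\omega^n\mid \mathrm{o.t.}(P)<\omega^n\}$, where $\mathrm{o.t.}(P)$ is the order type of $P$ as a suborder of $(\omega^n,<)$. An ordinal Büchi automaton is a tuple $(\Sigma,Q,q_0,\Delta,\gamma,F)$ with finite alphabet $\Sigma$, finite state set $Q$, initial state $q_0$, successor transitions $\Delta\subseteq Q\times\Sigma\times Q$, limit transitions $\gamma\subseteq\mathcal{P}(Q)\times Q$, final states $F$. A run on a word $\sigma$ of length $\alpha$ is $(x(i))_{i\le\alpha}$ with $x(0)=q_0$, $(x(i),\sigma(i),x(i+1))\in\Delta$ for $i<\alpha$, and $(\mathrm{Inf}(x,i),x(i))\in\gamma$ for limit $i\le\alpha$, where $\mathrm{Inf}(x,i)$ is the set of states appearing cofinally often below $i$; the word is accepted if some run has $x(\alpha)\in F$. An $\omega^n$-automaton is such an automaton reading words of length $\omega^n$. *)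

theory Defs
  imports "HOL-Library.Multiset_Order" "HOL-Library.FuncSet"
begin

text \<open>
  Ordinals are elements of a well-ordered type with least element. As usual, an ordinal
  \<open>\<alpha>\<close> is identified with the set \<open>{..<\<alpha>}\<close> of its predecessors.
\<close>

definition is_succ :: "'o::wellorder \<Rightarrow> 'o \<Rightarrow> bool" where
  "is_succ i j \<longleftrightarrow> i < j \<and> (\<forall>k. i < k \<longrightarrow> j \<le> k)"

definition is_limit :: "'o::{wellorder, order_bot} \<Rightarrow> bool" where
  "is_limit i \<longleftrightarrow> i \<noteq> bot \<and> (\<nexists>j. is_succ j i)"

record ('a, 'q) ord_automaton =
  alphabet :: "'a set"
  states :: "'q set"
  init :: 'q
  succ_trans :: "('q \<times> 'a \<times> 'q) set"
  lim_trans :: "('q set \<times> 'q) set"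
  final :: "'q set"

definition ord_buchi_automaton :: "('a, 'q) ord_automaton \<Rightarrow> bool" where
  "ord_buchi_automaton A \<longleftrightarrow>
     finite (alphabet A) \<and> finite (states A) \<and> init A \<in> states A \<and>
     succ_trans A \<subseteq> states A \<times> alphabet A \<times> states A \<and>
     lim_trans A \<subseteq> Pow (states A) \<times> states A \<and>
     final A \<subseteq> states A"

definition Inf_states :: "('o::wellorder \<Rightarrow> 'q) \<Rightarrow> 'o \<Rightarrow> 'q set" where
  "Inf_states x i = {q. \<forall>j<i. \<exists>k. j \<le> k \<and> k < i \<and> x k = q}"

text \<open>Only the values of \<open>\<sigma>\<close> below \<open>\<alpha>\<close> and of \<open>x\<close> up to and including \<open>\<alpha>\<close> matter.\<close>

definition is_run ::
  "('a, 'q) ord_automaton \<Rightarrow> 'o::{wellorder, order_bot} \<Rightarrow> ('o \<Rightarrow> 'a) \<Rightarrow> ('o \<Rightarrow> 'q) \<Rightarrow> bool" where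
  "is_run A \<alpha> \<sigma> x \<longleftrightarrow>
     (\<forall>i\<le>\<alpha>. x i \<in> states A) \<and>
     x bot = init A \<and>
     (\<forall>i<\<alpha>. \<forall>j. is_succ i j \<longrightarrow> (x i, \<sigma> i, x j) \<in> succ_trans A) \<and>
     (\<forall>i\<le>\<alpha>. is_limit i \<longrightarrow> (Inf_states x i, x i) \<in> lim_trans A)"

definition accepts ::
  "('a, 'q) ord_automaton \<Rightarrow> 'o::{wellorder, order_bot} \<Rightarrow> ('o \<Rightarrow> 'a) \<Rightarrow> bool" where
  "accepts A \<alpha> \<sigma> \<longleftrightarrow> (\<exists>x. is_run A \<alpha> \<sigma> x \<and> x \<alpha> \<in> final A)"

definition words :: "'a set \<Rightarrow> 'o::wellorder \<Rightarrow> ('o \<Rightarrow> 'a) set" where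
  "words \<Sigma> \<alpha> = {..<\<alpha>} \<rightarrow>\<^sub>E \<Sigma>"

definition language ::
  "('a, 'q) ord_automaton \<Rightarrow> 'o::{wellorder, order_bot} \<Rightarrow> ('o \<Rightarrow> 'a) set" where
  "language A \<alpha> = {\<sigma> \<in> words (alphabet A) \<alpha>. accepts A \<alpha> \<sigma>}"

text \<open>State sets are finite, so drawing the states from \<open>nat\<close> loses no generality.\<close>

definition regular_language ::
  "'a set \<Rightarrow> 'o::{wellorder, order_bot} \<Rightarrow> ('o \<Rightarrow> 'a) set \<Rightarrow> bool" where
  "regular_language \<Sigma> \<alpha> L \<longleftrightarrow>
     (\<exists>A :: ('a, nat) ord_automaton.
        ord_buchi_automaton A \<and> alphabet A = \<Sigma> \<and> L = language A \<alpha>)"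

text \<open>
  The order type of a set \<open>P\<close> is represented by the well-order on \<open>P\<close>
  induced from the ambient type; order types are compared with \<^const>\<open>ordLess\<close>.
\<close>

definition suborder :: "'o::wellorder set \<Rightarrow> 'o rel" where
  "suborder P = {(a, b). a \<in> P \<and> b \<in> P \<and> a \<le> b}"

lemma Field_suborder [simp]: "Field (suborder P) = P"
  by (auto simp: suborder_def Field_def)

lemma Well_order_suborder: "Well_order (suborder P)"
proof -
  have "suborder P - Id \<subseteq> {(a, b). a < b}"
    by (auto simp: suborder_def)
  hence "wf (suborder P - Id)"
    using wf wf_subset by blast
  thus ?thesis
    by (auto simp: well_order_on_def linear_order_on_def partial_order_on_def preorder_on_def
        refl_on_def trans_def antisym_def total_on_def suborder_def Field_def)
qed

text \<open>
  Ordinals below \<open>\<omega>\<^sup>\<omega>\<close> in Cantor normal form: the multiset \<open>{#k\<^sub>1, \<dots>, k\<^sub>m#}\<close> with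
  \<open>k\<^sub>1 \<ge> \<dots> \<ge> k\<^sub>m\<close> stands for \<open>\<omega>\<^bsup>k\<^sub>1\<^esup> + \<dots> + \<omega>\<^bsup>k\<^sub>m\<^esup>\<close>. The multiset order compares the
  coefficients at the largest exponent where they differ, i.e. it is the order of ordinals.
  The lemmas below confirm that \<open>omega_pow n\<close> is \<open>\<omega>\<^sup>n\<close>: it has exactly one predecessor for
  \<open>n = 0\<close>, and \<open>omega_pow (Suc n)\<close> consists of \<open>\<omega>\<close> consecutive copies of \<open>omega_pow n\<close>.
\<close>

definition omega_pow :: "nat \<Rightarrow> nat multiset" where
  "omega_pow n = {#n#}"

lemma lessThan_omega_pow_0: "{..<omega_pow 0} = {bot}"
  by (auto simp: omega_pow_def bot_multiset_def)

lemma lessThan_omega_pow_Suc: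
  "bij_betw (\<lambda>(k, M). replicate_mset k n + M)
     (UNIV \<times> {..<omega_pow n}) {..<omega_pow (Suc n)}"
  unfolding bij_betw_def
proof
  have k: "count (replicate_mset k n + M) n = k" if "M < omega_pow n" for k M
    using that by (auto simp: omega_pow_def count_eq_zero_iff)
  show "inj_on (\<lambda>(k, M). replicate_mset k n + M) (UNIV \<times> {..<omega_pow n})"
  proof (rule inj_onI, clarsimp)
    fix k M k' M'
    assume *: "M < omega_pow n" "M' < omega_pow n"
      "replicate_mset k n + M = replicate_mset k' n + M'"
    hence "k = k'"
      using k by metis
    thus "k = k' \<and> M = M'"
      using * by simp
  qed
  show "(\<lambda>(k, M). replicate_mset k n + M) ` (UNIV \<times> {..<omega_pow n}) = {..<omega_pow (Suc n)}"
  proof (intro equalityI subsetI)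
    fix N assume "N \<in> {..<omega_pow (Suc n)}"
    hence N: "\<forall>x\<in>#N. x < Suc n"
      by (simp add: omega_pow_def)
    have "N = replicate_mset (count N n) n + filter_mset (\<lambda>x. x \<noteq> n) N"
      by (rule multiset_eqI) auto
    moreover have "filter_mset (\<lambda>x. x \<noteq> n) N < omega_pow n"
      using N by (auto simp: omega_pow_def less_Suc_eq)
    ultimately show "N \<in> (\<lambda>(k, M). replicate_mset k n + M) ` (UNIV \<times> {..<omega_pow n})"
      by (intro image_eqI[of _ _ "(count N n, filter_mset (\<lambda>x. x \<noteq> n) N)"]) auto
  qed (auto simp: omega_pow_def less_Suc_eq split: if_splits)
qed

lemma less_omega_pow_blocks:
  assumes M: "M < omega_pow n" and M': "M' < omega_pow n"
  shows "replicate_mset k n + M < replicate_mset k' n + M' \<longleftrightarrow> k < k' \<or> k = k' \<and> M < M'"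
proof -
  have *: "replicate_mset k n + M < replicate_mset k' n + M'"
    if "k < k'" "M < omega_pow n" "M' < omega_pow n" for k k' M M'
  proof (rule ex_gt_count_imp_le_multiset[where x = n])
    show "\<forall>y. y \<in># replicate_mset k n + M + (replicate_mset k' n + M') \<longrightarrow> y \<le> n"
      using that by (auto simp: omega_pow_def less_imp_le split: if_splits)
    have "count M n = 0" "count M' n = 0"
      using that by (auto simp: omega_pow_def count_eq_zero_iff)
    thus "count (replicate_mset k n + M) n < count (replicate_mset k' n + M') n"
      using that by simp
  qed
  show ?thesis
  proof (cases k k' rule: linorder_cases)
    case less
    thus ?thesis using *[OF _ M M'] by simp
  next
    case equal
    thus ?thesis by simp
  next
    case greater
    thus ?thesis using *[OF _ M' M] by (auto dest: less_asym)
  qed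
qed

definition I_omega :: "nat \<Rightarrow> nat multiset set set" where
  "I_omega n = {P. P \<subseteq> {..<omega_pow n} \<and>
                   (suborder P, suborder {..<omega_pow n}) \<in> ordLess}"

definition char_word :: "nat \<Rightarrow> nat multiset set \<Rightarrow> nat multiset \<Rightarrow> nat" where
  "char_word n P = (\<lambda>\<alpha>\<in>{..<omega_pow n}. if \<alpha> \<in> P then 1 else 0)"

definition L_omega :: "nat \<Rightarrow> (nat multiset \<Rightarrow> nat) set" where
  "L_omega n = {char_word n P | P. P \<in> I_omega n}"

end

theory Submission
  imports Defs "HOL-Library.Infinite_Set"
begin

text \<open>
  Cut \<open>\<omega>\<^bsup>m+1\<^esup>\<close> into \<open>\<omega>\<close> consecutive blocks of length \<open>\<omega>\<^sup>m\<close>. A subset \<open>P\<close> has order type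
  \<open>\<omega>\<^bsup>m+1\<^esup>\<close> iff infinitely many blocks meet \<open>P\<close> in order type \<open>\<omega>\<^sup>m\<close>. A deterministic automaton
  checks this: at a nonzero position whose Cantor normal form ends in \<open>\<omega>\<^sup>m\<close> it stores the degree
  \<open>m\<close> and one bit telling whether the preceding block of length \<open>\<omega>\<^sup>m\<close> is full. At a limit position
  of degree \<open>p + 1\<close> the largest degree seen cofinally often is \<open>p\<close>, and the new bit is set iff
  degree \<open>p\<close> with its bit set occurs cofinally often.
\<close>

section \<open>The order on Cantor normal forms\<close>

text \<open>Only finitely many elements have different multiplicities, so there is a largest one,
  and it decides the comparison.\<close>

lemma less_multiset_iff_max_diff:
  fixes M N :: "'a::linorder multiset"
  shows "M < N \<longleftrightarrow> (\<exists>x. count M x < count N x \<and> (\<forall>y>x. count M y = count N y))"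
proof
  assume less: "M < N"
  let ?D = "{x. count M x \<noteq> count N x}"
  have "?D \<subseteq> set_mset M \<union> set_mset N"
    by (auto simp: count_eq_zero_iff) (metis not_in_iff)
  hence fin: "finite ?D"
    using finite_subset by blast
  have "?D \<noteq> {}"
    using less by (metis (mono_tags) Collect_empty_eq less_irrefl multiset_eq_iff)
  then obtain x where x: "count M x \<noteq> count N x" "\<And>y. count M y \<noteq> count N y \<Longrightarrow> y \<le> x"
    using fin Max_in[of ?D] Max_ge[of ?D] by blast
  hence above: "count M y = count N y" if "y > x" for y
    using that not_less by blast
  hence "\<not> count N x < count M x"
    using less unfolding less_multiset\<^sub>H\<^sub>O by (metis less_irrefl)
  hence "count M x < count N x"
    using x(1) by simp
  thus "\<exists>x. count M x < count N x \<and> (\<forall>y>x. count M y = count N y)"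
    using above by blast
next
  assume "\<exists>x. count M x < count N x \<and> (\<forall>y>x. count M y = count N y)"
  then obtain x where x: "count M x < count N x" "\<And>y. y > x \<Longrightarrow> count M y = count N y"
    by blast
  show "M < N"
    unfolding less_multiset\<^sub>H\<^sub>O
  proof (intro conjI allI impI)
    show "M \<noteq> N"
      using x(1) by auto
    fix y assume "count N y < count M y"
    hence "y < x"
      using x by (metis less_irrefl less_asym linorder_neqE)
    thus "\<exists>z>y. count M z < count N z"
      using x(1) by blast
  qed
qed

text \<open>The exponent \<open>0\<close> contributes the ordinal 1. If \<open>K\<close> lay
  strictly in between, its largest differences \<open>x\<close> and \<open>z\<close> from the two
  ends would be contradictory in each relative order, as the ends differ only in the count of
  \<open>0\<close>.\<close>

lemma is_succ_add_mset_0: "is_succ (M :: nat multiset) (add_mset 0 M)"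
  unfolding is_succ_def
proof (intro conjI allI impI)
  show "M < add_mset 0 M"
    by simp
  fix K assume "M < K"
  then obtain x where x: "count M x < count K x" "\<And>y. y > x \<Longrightarrow> count M y = count K y"
    unfolding less_multiset_iff_max_diff by blast
  show "add_mset 0 M \<le> K"
  proof (rule ccontr)
    assume "\<not> ?thesis"
    hence "K < add_mset 0 M"
      by simp
    then obtain z where z: "count K z < count (add_mset 0 M) z"
      "\<And>y. y > z \<Longrightarrow> count K y = count (add_mset 0 M) y"
      unfolding less_multiset_iff_max_diff by blast
    show False
      using z(1) x(1) x(2)[of z] z(2)[of x]
      by (cases x z rule: linorder_cases) (auto split: if_splits)
  qed
qed

lemma is_succ_iff: "is_succ M N \<longleftrightarrow> N = add_mset 0 (M :: nat multiset)"
proof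
  assume "is_succ M N"
  thus "N = add_mset 0 M"
    using is_succ_add_mset_0[of M] unfolding is_succ_def by (meson antisym)
qed (simp add: is_succ_add_mset_0)

lemma is_limit_iff: "is_limit (M :: nat multiset) \<longleftrightarrow> M \<noteq> {#} \<and> 0 \<notin># M"
  unfolding is_limit_def is_succ_iff bot_multiset_def
  by (auto dest: mset_add)

lemma less_omega_pow_iff: "M < omega_pow n \<longleftrightarrow> (\<forall>x\<in>#M. x < n)"
  by (simp add: omega_pow_def)

text \<open>If the largest exponent at which \<open>K\<close> differs from \<open>N\<close> were at
  least \<open>m\<close>, then \<open>K\<close> would reach \<open>add_mset m N\<close>. As all
  exponents of \<open>N\<close> are at least \<open>m\<close>, the multiset sum \<open>N + X\<close>
  is also the ordinal sum.\<close>

lemma block_decompose: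
  fixes N K :: "nat multiset"
  assumes N: "\<And>y. y \<in># N \<Longrightarrow> m \<le> y" and "N \<le> K" "K < add_mset m N"
  obtains X where "K = N + X" "X < omega_pow m"
proof -
  have N0: "count N y = 0" if "y < m" for y
    using N[of y] that by (auto simp: count_eq_zero_iff)
  have "count K y = count N y" if y: "m \<le> y" for y
  proof (cases "N = K")
    case False
    then obtain x where x: "count N x < count K x" "\<And>y. y > x \<Longrightarrow> count N y = count K y"
      using \<open>N \<le> K\<close> less_multiset_iff_max_diff[of N K] by fastforce
    obtain z where z: "count K z < count (add_mset m N) z"
      "\<And>y. y > z \<Longrightarrow> count K y = count (add_mset m N) y"
      using \<open>K < add_mset m N\<close> less_multiset_iff_max_diff[of K] by blast
    \<comment> \<open>Below \<open>m\<close> all counts in \<open>add_mset m N\<close> are 0, so no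
      count can be strictly smaller there.\<close>
    have "m \<le> z"
      using z(1) N0[of z] by (metis count_add_mset nat_neq_iff not_less not_less_zero)
    hence "x < m"
      using x(1) x(2)[of z] z(1) z(2)[of x]
      by (cases x z rule: linorder_cases) (auto split: if_splits)
    thus ?thesis
      using x(2)[of y] y by simp
  qed simp
  hence eq: "count K y = count N y" if "m \<le> y" for y
    using that by blast
  hence "N \<subseteq># K"
    using N0 by (metis le0 order_refl mset_subset_eqI not_less)
  moreover have "K - N < omega_pow m"
    unfolding less_omega_pow_iff
    using eq by (metis count_diff count_greater_zero_iff diff_self_eq_0 less_irrefl not_less)
  ultimately show ?thesis
    using that[of "K - N"] by simp
qed

text \<open>For \<open>J\<close> beyond \<open>N\<close>, it suffices to take \<open>l\<close> one
  larger than the coefficient of omega^p in the remainder of \<open>J\<close>.\<close>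

lemma block_cofinal:
  fixes N J :: "nat multiset"
  assumes N: "\<And>y. y \<in># N \<Longrightarrow> Suc p \<le> y" and J: "J < add_mset (Suc p) N"
  obtains l where "J \<le> N + replicate_mset l p"
proof (cases "J \<le> N")
  case True
  thus ?thesis
    using that[of 0] by simp
next
  case False
  then obtain X where X: "J = N + X" "X < omega_pow (Suc p)"
    using block_decompose[of N "Suc p" J] N J by (metis linear)
  have "count X y = 0" if "y > p" for y
    using that X(2) by (force simp: less_omega_pow_iff count_eq_zero_iff)
  hence "X < replicate_mset (Suc (count X p)) p"
    unfolding less_multiset_iff_max_diff by (intro exI[of _ p]) auto
  thus ?thesis
    using that[of "Suc (count X p)"] X(1) by (simp add: less_imp_le)
qed

section \<open>Sets of full order type\<close>

text \<open>On a block of length omega^m starting at \<open>N\<close>, with all exponents of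
  \<open>N\<close> at least \<open>m\<close>, this moves the trace of \<open>P\<close> to the
  origin. Nothing is cut off beyond the block; \<open>full m\<close> looks only at members below
  \<open>omega_pow m\<close>.\<close>

definition shift :: "nat multiset \<Rightarrow> nat multiset set \<Rightarrow> nat multiset set" where
  "shift N P = {X. N + X \<in> P}"

lemma mem_shift [simp]: "X \<in> shift N P \<longleftrightarrow> N + X \<in> P"
  by (simp add: shift_def)

lemma shift_shift: "shift M (shift N P) = shift (N + M) P"
  by (simp add: shift_def add.assoc)

text \<open>Inductive form of the condition that the part of \<open>P\<close> below
  \<open>omega_pow n\<close> has order type omega^n, evaluated block by block.\<close>

primrec full :: "nat \<Rightarrow> nat multiset set \<Rightarrow> bool" where
  "full 0 P \<longleftrightarrow> {#} \<in> P"
| "full (Suc n) P \<longleftrightarrow> infinite {k. full n (shift (replicate_mset k n) P)}"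

section \<open>Comparing order types through strictly increasing maps\<close>

text \<open>There is no least \<open>a\<close> with \<open>h a < a\<close>: applying
  \<open>h\<close> once more shows that \<open>h a\<close> is a smaller one.\<close>

lemma strict_mono_on_self_ge:
  fixes h :: "'o::wellorder \<Rightarrow> 'o"
  assumes "strict_mono_on A h" "h ` A \<subseteq> A" "a \<in> A"
  shows "a \<le> h a"
  using \<open>a \<in> A\<close>
proof (induction a rule: less_induct)
  case (less a)
  show ?case
  proof (rule ccontr)
    assume "\<not> a \<le> h a"
    hence lt: "h a < a"
      by simp
    have ha: "h a \<in> A"
      using assms(2) less.prems by blast
    have "h (h a) < h a"
      using strict_mono_onD[OF assms(1) ha less.prems lt] .
    thus False
      using less.IH[OF lt ha] by simp
  qed
qed

lemma embed_suborder_strict_mono_on: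
  assumes "embed (suborder A) (suborder B) g"
  shows "strict_mono_on A g" "g ` A \<subseteq> B"
proof -
  show "g ` A \<subseteq> B"
    using embed_Field[OF assms] by simp
  have inj: "inj_on g A"
    using embed_inj_on[OF Well_order_suborder assms] by simp
  show "strict_mono_on A g"
  proof (rule strict_mono_onI)
    fix r s assume "r \<in> A" "s \<in> A" "r < s"
    hence "(g r, g s) \<in> suborder B"
      using embed_compat[OF assms] by (auto simp: compat_def suborder_def)
    moreover have "g r \<noteq> g s"
      using inj \<open>r \<in> A\<close> \<open>s \<in> A\<close> \<open>r < s\<close> by (metis inj_onD less_irrefl)
    ultimately show "g r < g s"
      by (auto simp: suborder_def le_less)
  qed
qed

text \<open>Otherwise some \<open>g\<close> maps \<open>P\<close> onto a proper initial segment of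
  \<open>A\<close>, all below a missed point \<open>a\<close>. Then \<open>g \<circ> f\<close> is a
  strictly increasing self-map of \<open>A\<close> that sends \<open>a\<close> below itself.\<close>

lemma not_suborder_ordLess:
  fixes f :: "'o::wellorder \<Rightarrow> 'o"
  assumes f: "strict_mono_on A f" "f ` A \<subseteq> P"
  shows "(suborder P, suborder A) \<notin> ordLess"
proof
  assume "(suborder P, suborder A) \<in> ordLess"
  then obtain g where "embedS (suborder P) (suborder A) g"
    unfolding ordLess_def by auto
  hence g: "embed (suborder P) (suborder A) g" "\<not> bij_betw g P A"
    by (auto simp: embedS_def)
  note gm = embed_suborder_strict_mono_on[OF g(1)]
  have "inj_on g P"
    using embed_inj_on[OF Well_order_suborder g(1)] by simp
  then obtain a where a: "a \<in> A" "a \<notin> g ` P"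
    using g(2) gm(2) by (auto simp: bij_betw_def)
  \<comment> \<open>The image of an embedding is closed downwards, so a value at or above
    \<open>a\<close> would bring \<open>a\<close> into it.\<close>
  have "g p < a" if "p \<in> P" for p
  proof (rule ccontr)
    assume "\<not> g p < a"
    hence "a \<in> under (suborder A) (g p)"
      using a(1) gm(2) that by (auto simp: under_def suborder_def)
    moreover have "under (suborder A) (g p) = g ` under (suborder P) p"
      using g(1) that by (auto simp: embed_def bij_betw_def)
    ultimately show False
      using a(2) by (auto simp: under_def suborder_def)
  qed
  hence "(g \<circ> f) a < a"
    using f(2) a(1) by auto
  moreover have "a \<le> (g \<circ> f) a"
  proof (rule strict_mono_on_self_ge)
    show "strict_mono_on A (g \<circ> f)"
      using f gm(1) by (auto simp: strict_mono_on_def monotone_on_def image_subset_iff)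
    show "(g \<circ> f) ` A \<subseteq> A"
      using f(2) gm(2) by auto
  qed (rule a(1))
  ultimately show False
    by simp
qed

text \<open>Otherwise \<open>A\<close> embeds into \<open>P\<close> by some \<open>g\<close>, and
  \<open>f \<circ> g\<close> sends \<open>b\<close> below itself. The inclusion of
  \<open>{..b}\<close> in \<open>A\<close> makes \<open>f \<circ> g\<close> a self-map of
  \<open>A\<close>.\<close>

lemma suborder_ordLess:
  fixes f :: "'o::wellorder \<Rightarrow> 'o"
  assumes f: "strict_mono_on P f" "\<And>p. p \<in> P \<Longrightarrow> f p < b" "{..b} \<subseteq> A"
  shows "(suborder P, suborder A) \<in> ordLess"
proof (rule ccontr)
  assume "\<not> ?thesis"
  hence "(suborder A, suborder P) \<in> ordLeq"
    using not_ordLess_iff_ordLeq[OF Well_order_suborder Well_order_suborder] by blast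
  then obtain g where g: "embed (suborder A) (suborder P) g"
    unfolding ordLeq_def by auto
  note gm = embed_suborder_strict_mono_on[OF g]
  have fg: "f (g a) < b" if "a \<in> A" for a
    using f(2) gm(2) that by blast
  have "b \<le> (f \<circ> g) b"
  proof (rule strict_mono_on_self_ge)
    show "strict_mono_on A (f \<circ> g)"
      using f(1) gm by (auto simp: strict_mono_on_def monotone_on_def image_subset_iff)
    show "(f \<circ> g) ` A \<subseteq> A"
      using fg f(3) by (auto simp: less_imp_le)
    show "b \<in> A"
      using f(3) by auto
  qed
  thus False
    using fg[of b] f(3) by (auto simp: not_less[symmetric])
qed

section \<open>Full sets and their blocks\<close>

text \<open>For \<open>M < omega_pow (Suc n)\<close> this is the position of \<open>M\<close> inside
  block number \<open>count M n\<close> of length omega^n.\<close>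

definition low :: "nat \<Rightarrow> nat multiset \<Rightarrow> nat multiset" where
  "low n M = filter_mset (\<lambda>x. x \<noteq> n) M"

lemma split_low: "M = replicate_mset (count M n) n + low n M"
  unfolding low_def by (rule multiset_eqI) auto

lemma low_less: "M < omega_pow (Suc n) \<Longrightarrow> low n M < omega_pow n"
  by (auto simp: low_def less_omega_pow_iff less_Suc_eq)

lemma less_iff_count_low:
  assumes "M < omega_pow (Suc n)" "M' < omega_pow (Suc n)"
  shows "M < M' \<longleftrightarrow> count M n < count M' n \<or> count M n = count M' n \<and> low n M < low n M'"
  using less_omega_pow_blocks[OF low_less[OF assms(1)] low_less[OF assms(2)],
      of "count M n" "count M' n"] by (simp flip: split_low)

text \<open>Block \<open>k\<close> is sent into the \<open>k\<close>-th full block of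
  \<open>P\<close> by the increasing map that the induction hypothesis provides there.\<close>

lemma full_embedding:
  assumes "full n P"
  shows "\<exists>f. strict_mono_on {..<omega_pow n} f \<and> f ` {..<omega_pow n} \<subseteq> P \<inter> {..<omega_pow n}"
  using assms
proof (induction n arbitrary: P)
  case 0
  thus ?case
    by (intro exI[of _ id]) (auto simp: strict_mono_on_def monotone_on_def omega_pow_def)
next
  case (Suc n)
  define S where "S = {k. full n (shift (replicate_mset k n) P)}"
  have inf: "infinite S"
    using Suc.prems by (simp add: S_def)
  have "\<forall>k\<in>S. \<exists>f. strict_mono_on {..<omega_pow n} f \<and>
      f ` {..<omega_pow n} \<subseteq> shift (replicate_mset k n) P \<inter> {..<omega_pow n}"
    using Suc.IH by (auto simp: S_def)
  then obtain g where g: "\<And>k. k \<in> S \<Longrightarrow> strict_mono_on {..<omega_pow n} (g k)"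
    "\<And>k. k \<in> S \<Longrightarrow> g k ` {..<omega_pow n} \<subseteq> shift (replicate_mset k n) P \<inter> {..<omega_pow n}"
    by metis
  define e where "e = Infinite_Set.enumerate S"
  have e: "e k \<in> S" "e k < e k' \<longleftrightarrow> k < k'" for k k'
    using inf enumerate_in_set[OF inf] by (auto simp: e_def enumerate_mono_iff)
  define f where "f M = replicate_mset (e (count M n)) n + g (e (count M n)) (low n M)" for M
  have gl: "g (e k) (low n M) < omega_pow n"
    and gP: "replicate_mset (e k) n + g (e k) (low n M) \<in> P"
    if "M < omega_pow (Suc n)" for M k
    using g(2)[OF e(1)[of k]] low_less[OF that] by auto
  have "strict_mono_on {..<omega_pow (Suc n)} f"
  proof (rule strict_mono_onI)
    fix M M' assume M: "M \<in> {..<omega_pow (Suc n)}" "M' \<in> {..<omega_pow (Suc n)}" "M < M'"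
    have "g (e k) (low n M) < g (e k) (low n M')" if "low n M < low n M'" for k
      using strict_mono_onD[OF g(1)[OF e(1)[of k]], of "low n M" "low n M'"] that M low_less by auto
    thus "f M < f M'"
      using M less_iff_count_low[of M n M'] unfolding f_def
      by (subst less_omega_pow_blocks) (auto simp: gl e(2))
  qed
  moreover have "f ` {..<omega_pow (Suc n)} \<subseteq> P \<inter> {..<omega_pow (Suc n)}"
  proof (rule image_subsetI)
    fix M assume "M \<in> {..<omega_pow (Suc n)}"
    thus "f M \<in> P \<inter> {..<omega_pow (Suc n)}"
      using gl[of M "count M n"] gP[of M "count M n"]
      by (auto simp: f_def less_omega_pow_iff less_Suc_eq split: if_splits)
  qed
  ultimately show ?case
    by blast
qed

text \<open>The bound \<open>b\<close> serves the induction: it says how much room a block that is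
  not full needs, and such rooms can be lined up below omega^n. Since only blocks with number below
  some \<open>K\<close> are full, omega^n * (K + 1) is a bound at the next level.\<close>

lemma not_full_bounded:
  assumes "\<not> full n P"
  shows "\<exists>f. \<exists>b<omega_pow n. strict_mono_on (P \<inter> {..<omega_pow n}) f \<and>
           (\<forall>M\<in>P \<inter> {..<omega_pow n}. f M < b)"
  using assms
proof (induction n arbitrary: P)
  case 0
  hence "P \<inter> {..<omega_pow 0} = {}"
    by (auto simp: omega_pow_def)
  \<comment> \<open>\<open>P\<close> has no member below omega^0 = 1, so the ordinal 0, written
    \<open>{#}\<close>, is a bound vacuously.\<close>
  thus ?case
    by (auto simp: strict_mono_on_def monotone_on_def less_omega_pow_iff intro!: exI[of _ "{#}"])
next
  case (Suc n)
  let ?Q = "\<lambda>k. shift (replicate_mset k n) P \<inter> {..<omega_pow n}"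
  have "finite {k. full n (shift (replicate_mset k n) P)}"
    using Suc.prems by simp
  then obtain K where K: "\<And>k. full n (shift (replicate_mset k n) P) \<Longrightarrow> k < K"
    using finite_nat_set_iff_bounded by auto
  have "\<forall>k\<in>{K..}. \<exists>f b. b < omega_pow n \<and> strict_mono_on (?Q k) f \<and> (\<forall>M\<in>?Q k. f M < b)"
    using Suc.IH K by (meson atLeast_iff not_less)
  from bchoice[OF this] obtain g where "\<forall>k\<in>{K..}. \<exists>b. b < omega_pow n \<and>
      strict_mono_on (?Q k) (g k) \<and> (\<forall>M\<in>?Q k. g k M < b)"
    by blast
  from bchoice[OF this] obtain b where b: "\<forall>k\<in>{K..}. b k < omega_pow n \<and>
      strict_mono_on (?Q k) (g k) \<and> (\<forall>M\<in>?Q k. g k M < b k)"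
    by blast
  have g: "b k < omega_pow n" "strict_mono_on (?Q k) (g k)" "\<And>M. M \<in> ?Q k \<Longrightarrow> g k M < b k"
    if "K \<le> k" for k
    using bspec[OF b, of k] that by (simp_all del: Int_iff)
  \<comment> \<open>The blocks from \<open>K\<close> on are squeezed into a single block. Multiset union is the natural sum
    of ordinals, which is strictly monotone in both arguments.\<close>
  define s where "s k = (\<Sum>i\<in>{K..<k}. b i)" for k
  define h where "h M = (if count M n < K then low n M
    else s (count M n) + g (count M n) (low n M))" for M
  define f where "f M = replicate_mset (min K (count M n)) n + h M" for M
  have lowQ: "low n M \<in> ?Q (count M n)" if "M \<in> P \<inter> {..<omega_pow (Suc n)}" for M
    using that low_less[of M n] by (simp flip: split_low)
  \<comment> \<open>A finite sum of multisets with exponents below \<open>n\<close> has exponents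
    below \<open>n\<close>, so the accumulated bounds never leave a single block.\<close>
  have s_less: "s k < omega_pow n" for k
    using g(1) by (auto simp: s_def less_omega_pow_iff set_mset_sum)
  have h_less: "h M < omega_pow n" if "M \<in> P \<inter> {..<omega_pow (Suc n)}" for M
  proof (cases "count M n < K")
    case True
    thus ?thesis
      using that low_less by (auto simp: h_def)
  next
    case False
    hence "g (count M n) (low n M) < omega_pow n"
      using g(1)[of "count M n"] g(3)[OF _ lowQ[OF that]] by (meson less_trans not_less)
    thus ?thesis
      using False s_less[of "count M n"] by (auto simp: h_def less_omega_pow_iff)
  qed
  \<comment> \<open>The interval from \<open>s k\<close> to \<open>s k + b k\<close> reserved for
    block \<open>k\<close> ends no later than the one for any later block begins.\<close>
  have s_mono: "s k + b k \<le> s k'" if "K \<le> k" "k < k'" for k k'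
  proof -
    have "{K..<k'} = {K..<Suc k} \<union> {Suc k..<k'}"
      using that by auto
    hence "s k' = (s k + b k) + (\<Sum>i\<in>{Suc k..<k'}. b i)"
      using that by (simp add: s_def sum.union_disjoint)
    thus ?thesis
      by (simp add: subset_eq_imp_le_multiset)
  qed
  have "strict_mono_on (P \<inter> {..<omega_pow (Suc n)}) f"
  proof (rule strict_mono_onI)
    fix M M'
    assume M: "M \<in> P \<inter> {..<omega_pow (Suc n)}" "M' \<in> P \<inter> {..<omega_pow (Suc n)}" "M < M'"
    let ?k = "count M n" and ?k' = "count M' n"
    have cases: "?k < ?k' \<or> ?k = ?k' \<and> low n M < low n M'"
      using less_iff_count_low M by auto
    \<comment> \<open>Blocks below \<open>K\<close> keep their number; all others are given number
      \<open>K\<close>, where \<open>h\<close> has to do the ordering.\<close>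
    have "min K ?k < min K ?k' \<or> min K ?k = min K ?k' \<and> h M < h M'"
    proof (cases "?k < K")
      case True
      thus ?thesis
        using cases by (auto simp: h_def)
    next
      case False
      hence k: "K \<le> ?k" "K \<le> ?k'"
        using cases by auto
      have "h M < h M'"
      proof (cases "?k = ?k'")
        case True
        have "g ?k (low n M) < g ?k (low n M')"
          using strict_mono_onD[OF g(2)[OF k(1)] lowQ[OF M(1)], of "low n M'"]
            lowQ[OF M(2)] True cases by auto
        thus ?thesis
          using True k by (simp add: h_def)
      next
        case False
        have "h M < s ?k + b ?k"
          using g(3)[OF k(1) lowQ[OF M(1)]] k by (simp add: h_def)
        also have "\<dots> \<le> s ?k'"
          using s_mono[OF k(1)] False cases by blast
        also have "\<dots> \<le> h M'"
          using k by (simp add: h_def subset_eq_imp_le_multiset)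
        finally show ?thesis .
      qed
      thus ?thesis
        using k by simp
    qed
    thus "f M < f M'"
      unfolding f_def using less_omega_pow_blocks[OF h_less[OF M(1)] h_less[OF M(2)]] by simp
  qed
  moreover have "f M < replicate_mset (Suc K) n" if "M \<in> P \<inter> {..<omega_pow (Suc n)}" for M
    using less_omega_pow_blocks[OF h_less[OF that], of "{#}" "min K (count M n)" "Suc K"]
    by (simp add: f_def less_omega_pow_iff)
  moreover have "replicate_mset (Suc K) n < omega_pow (Suc n)"
    by (auto simp: less_omega_pow_iff)
  ultimately show ?case
    by blast
qed

lemma I_omega_iff_not_full:
  assumes "P \<subseteq> {..<omega_pow n}"
  shows "P \<in> I_omega n \<longleftrightarrow> \<not> full n P"
proof
  assume P: "P \<in> I_omega n"
  show "\<not> full n P"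
  proof
    assume "full n P"
    then obtain f where "strict_mono_on {..<omega_pow n} f" "f ` {..<omega_pow n} \<subseteq> P"
      using full_embedding[of n P] by auto
    hence "(suborder P, suborder {..<omega_pow n}) \<notin> ordLess"
      by (rule not_suborder_ordLess)
    thus False
      using P by (simp add: I_omega_def)
  qed
next
  have P: "P \<inter> {..<omega_pow n} = P"
    using assms by blast
  assume "\<not> full n P"
  then obtain f b where "b < omega_pow n" "strict_mono_on P f" "\<forall>M\<in>P. f M < b"
    using not_full_bounded[of n P] unfolding P by blast
  hence "(suborder P, suborder {..<omega_pow n}) \<in> ordLess"
    by (intro suborder_ordLess[of P f b]) auto
  thus "P \<in> I_omega n"
    using assms by (simp add: I_omega_def)
qed

section \<open>The automaton\<close>

text \<open>The state with degree \<open>m\<close> and bit \<open>b\<close> is encoded as \<open>2 * m + of_bool b\<close>.\<close>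

definition block_state :: "nat multiset set \<Rightarrow> nat multiset \<Rightarrow> nat" where
  "block_state P M = (if M = {#} then 0 else
     let m = Min_mset M in 2 * m + of_bool (full m (shift (M - {#m#}) P)))"

text \<open>\<open>q div 2\<close> reads off the degree, and \<open>2 * p + 1\<close> is the code of
  degree \<open>p\<close> with its bit set.\<close>

definition limit_state :: "nat set \<Rightarrow> nat" where
  "limit_state S = (let p = Max ((\<lambda>q. q div 2) ` S) in 2 * Suc p + of_bool (2 * p + 1 \<in> S))"

text \<open>The block before a successor position is a single position, so the letter just read is
  the new code, of degree 0. The bound on \<open>q\<close> in \<open>lim_trans\<close> excludes
  degrees above \<open>n\<close>. The final code is degree \<open>n\<close> with its bit
  unset.\<close>

definition full_automaton :: "nat \<Rightarrow> (nat, nat) ord_automaton" where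
  "full_automaton n =
     \<lparr>alphabet = {0, 1}, states = {..2 * n + 1}, init = 0,
      succ_trans = {(q, a, q'). q \<le> 2 * n + 1 \<and> a \<in> {0, 1} \<and> q' = a},
      lim_trans = {(S, q). S \<subseteq> {..2 * n + 1} \<and> q = limit_state S \<and> q \<le> 2 * n + 1},
      final = {2 * n}\<rparr>"

text \<open>\<open>m\<close> is the least exponent of \<open>add_mset m N\<close>, and removing it
  leaves the start \<open>N\<close> of the block that ends there.\<close>

lemma block_state_add:
  assumes "\<And>y. y \<in># N \<Longrightarrow> m \<le> y"
  shows "block_state P (add_mset m N) = 2 * m + of_bool (full m (shift N P))"
proof -
  have "Min_mset (add_mset m N) = m"
    by (rule Min_eqI) (use assms in auto)
  thus ?thesis
    by (simp add: block_state_def Let_def)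
qed

lemma block_state_div_2: "M \<noteq> {#} \<Longrightarrow> block_state P M div 2 = Min_mset M"
  by (simp add: block_state_def Let_def)

lemma block_state_bound:
  assumes "M \<le> omega_pow n"
  shows "block_state P M \<le> 2 * n + 1"
proof (cases "M = {#}")
  case False
  have "\<forall>x\<in>#M. x \<le> n"
    using assms by (cases "M = omega_pow n")
      (auto simp: omega_pow_def le_less less_omega_pow_iff[unfolded omega_pow_def])
  hence "Min_mset M \<le> n"
    using False by (simp add: Min_le_iff ex_in_conv)
  thus ?thesis
    using block_state_div_2[OF False, of P] by linarith
qed (simp add: block_state_def)

section \<open>States seen cofinally often below a limit\<close>

lemma Inf_states_cong:
  assumes "\<And>k. k < i \<Longrightarrow> x k = y k"
  shows "Inf_states x i = Inf_states y i"
  using assms unfolding Inf_states_def by (metis (mono_tags, lifting))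

text \<open>From N + omega^p on, every position below N + omega^(p+1) is N + X with X nonzero and
  with exponents at most \<open>p\<close>, so its degree is at most \<open>p\<close>. The degree
  equals \<open>p\<close> exactly for X = omega^p * (k + 1), where block \<open>k\<close> ends;
  hence bit \<open>c\<close> recurs cofinally iff infinitely many blocks carry it.\<close>

lemma Inf_states_block_state:
  fixes N :: "nat multiset" and P :: "nat multiset set"
  assumes N: "\<And>y. y \<in># N \<Longrightarrow> Suc p \<le> y"
  defines "S \<equiv> Inf_states (block_state P) (add_mset (Suc p) N)"
  shows "q \<in> S \<Longrightarrow> q div 2 \<le> p"
    and "2 * p + of_bool c \<in> S \<longleftrightarrow>
           infinite {k. full p (shift (replicate_mset k p) (shift N P)) = c}"
proof -
  let ?M = "add_mset (Suc p) N"
  let ?r = "\<lambda>l. replicate_mset l p"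
  have r_less: "N + ?r l < ?M" for l
  proof -
    have "?r l < {#Suc p#}"
      by auto
    thus ?thesis
      by (metis add_mset_add_single add_strict_left_mono)
  qed
  have decompose: "\<exists>X. K = N + X \<and> X < omega_pow (Suc p) \<and> ?r l \<le> X"
    if le: "N + ?r l \<le> K" and less: "K < ?M" for K l
  proof -
    have "N \<le> K"
      using le by (meson subset_eq_imp_le_multiset mset_subset_eq_add_left order_trans)
    then obtain X where "K = N + X" "X < omega_pow (Suc p)"
      using block_decompose[of N "Suc p" K] N less by blast
    thus ?thesis
      using le by auto
  qed
  have Min_block: "Min_mset (N + X) = Min_mset X" if "X < omega_pow (Suc p)" "X \<noteq> {#}" for X
  proof (rule Min_eqI)
    have mem: "Min_mset X \<in># X"
      using that(2) by simp
    thus "Min_mset X \<in># N + X"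
      by simp
    fix y assume "y \<in># N + X"
    thus "Min_mset X \<le> y"
      using N[of y] mem that(1) by (auto simp: less_omega_pow_iff)
  qed simp
  have state_r: "block_state P (N + ?r (Suc l)) =
      2 * p + of_bool (full p (shift (?r l) (shift N P)))" for l
    using block_state_add[of "N + ?r l" p P] N
    by (force simp: shift_shift split: if_splits)
  show "q div 2 \<le> p" if q: "q \<in> S"
  proof -
    \<comment> \<open>Starting at \<open>?r 1\<close> excludes \<open>N\<close> itself, whose
      exponents all exceed \<open>p\<close>.\<close>
    obtain K where K: "N + ?r 1 \<le> K" "K < ?M" "block_state P K = q"
      using q r_less[of 1] unfolding S_def Inf_states_def by blast
    obtain X where X: "K = N + X" "X < omega_pow (Suc p)" "?r 1 \<le> X"
      using decompose[OF K(1,2)] by blast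
    have "X \<noteq> {#}"
      using X(3) by auto
    hence "Min_mset X \<in># X"
      by simp
    hence "Min_mset X \<le> p"
      using X(2) by (force simp: less_omega_pow_iff)
    thus ?thesis
      using block_state_div_2[of K P] K(3) X(1) Min_block[OF X(2) \<open>X \<noteq> {#}\<close>] \<open>X \<noteq> {#}\<close> by simp
  qed
  show "2 * p + of_bool c \<in> S \<longleftrightarrow>
      infinite {k. full p (shift (?r k) (shift N P)) = c}"
  proof
    assume q: "2 * p + of_bool c \<in> S"
    show "infinite {k. full p (shift (?r k) (shift N P)) = c}"
      unfolding infinite_nat_iff_unbounded_le
    proof
      fix l
      \<comment> \<open>The lower bound uses \<open>Suc l\<close> because the position with
        coefficient \<open>Suc k\<close> reports on block \<open>k\<close>.\<close>
      obtain K where K: "N + ?r (Suc l) \<le> K" "K < ?M" "block_state P K = 2 * p + of_bool c"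
        using q r_less[of "Suc l"] unfolding S_def Inf_states_def by blast
      obtain X where X: "K = N + X" "X < omega_pow (Suc p)" "?r (Suc l) \<le> X"
        using decompose[OF K(1,2)] by blast
      have ne: "X \<noteq> {#}"
        using X(3) by auto
      have "block_state P K div 2 = p"
        using K(3) by simp
      hence "Min_mset X = p"
        using block_state_div_2[of K P] X(1) Min_block[OF X(2) ne] ne by simp
      hence "y = p" if "y \<in># X" for y
        using bspec[OF X(2)[unfolded less_omega_pow_iff] that] Min_le[of "set_mset X" y] that
        by (simp add: less_Suc_eq_le)
      hence Xr: "X = ?r (size X)"
        by (metis set_mset_subset_singletonD singletonI subsetI)
      have "Suc l \<le> size X"
      proof (rule ccontr)
        assume "\<not> ?thesis"
        hence "?r (size X) < ?r (Suc l)"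
          using less_omega_pow_blocks[of "{#}" p "{#}" "size X" "Suc l"]
          by (simp add: less_omega_pow_iff)
        thus False
          using X(3) Xr by (metis not_less)
      qed
      then obtain k where k: "size X = Suc k" "l \<le> k"
        by (cases "size X") auto
      have "of_bool (full p (shift (?r k) (shift N P))) = (of_bool c :: nat)"
        using state_r[of k] K(3) X(1) Xr k(1) by (metis add_left_cancel)
      thus "\<exists>k\<ge>l. k \<in> {k. full p (shift (?r k) (shift N P)) = c}"
        using k(2) unfolding of_bool_eq_iff by blast
    qed
  next
    assume inf: "infinite {k. full p (shift (?r k) (shift N P)) = c}"
    show "2 * p + of_bool c \<in> S"
      unfolding S_def Inf_states_def
    proof (intro CollectI allI impI)
      fix J assume "J < ?M"
      then obtain l where l: "J \<le> N + ?r l"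
        using block_cofinal[of N p J] N by blast
      obtain k where k: "l \<le> k" "full p (shift (?r k) (shift N P)) = c"
        using inf unfolding infinite_nat_iff_unbounded_le by blast
      have "?r l \<le> ?r (Suc k)"
        using k(1) by (intro subset_eq_imp_le_multiset) (simp add: subseteq_mset_def)
      hence "J \<le> N + ?r (Suc k)"
        using l by (meson add_left_mono order_trans)
      thus "\<exists>K\<ge>J. K < ?M \<and> block_state P K = 2 * p + of_bool c"
        using r_less[of "Suc k"] state_r[of k] k(2) by blast
    qed
  qed
qed

lemma block_state_limit:
  assumes "M \<noteq> {#}" "0 \<notin># M"
  shows "block_state P M = limit_state (Inf_states (block_state P) M)"
proof -
  have Min: "Min_mset M \<in># M"
    using assms(1) by simp
  then obtain p where p: "Min_mset M = Suc p"
    using assms(2) by (metis not0_implies_Suc)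
  define N where "N = M - {#Suc p#}"
  have M: "M = add_mset (Suc p) N"
    using Min by (simp add: N_def p)
  have N: "Suc p \<le> y" if "y \<in># N" for y
    using that p Min_le[of "set_mset M" y] M by simp
  let ?S = "Inf_states (block_state P) M"
  let ?F = "\<lambda>c. {k. full p (shift (replicate_mset k p) (shift N P)) = c}"
  have S: "q div 2 \<le> p" if "q \<in> ?S" for q
    using Inf_states_block_state(1)[of N p q P] N that unfolding M by blast
  have Sc: "2 * p + of_bool c \<in> ?S \<longleftrightarrow> infinite (?F c)" for c
    using Inf_states_block_state(2)[of N p c P] N unfolding M by blast
  \<comment> \<open>By pigeonhole one of the two bits occurs for infinitely many blocks, so degree
    \<open>p\<close> is indeed seen cofinally often and is the maximum.\<close>
  have "?F True \<union> ?F False = UNIV"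
    by auto
  hence "infinite (?F True) \<or> infinite (?F False)"
    by (metis finite_UnI infinite_UNIV_nat)
  then obtain c where "2 * p + of_bool c \<in> ?S"
    using Sc by blast
  hence "p \<in> (\<lambda>q. q div 2) ` ?S"
    by (intro image_eqI) auto
  moreover have "finite ((\<lambda>q. q div 2) ` ?S)"
    using S by (auto intro: finite_subset[of _ "{..p}"])
  ultimately have "Max ((\<lambda>q. q div 2) ` ?S) = p"
    using S by (intro Max_eqI) blast+
  moreover have "2 * p + 1 \<in> ?S \<longleftrightarrow> full (Suc p) (shift N P)"
    using Sc[of True] by simp
  ultimately have "limit_state ?S = 2 * Suc p + of_bool (full (Suc p) (shift N P))"
    unfolding limit_state_def by (simp add: Let_def)
  thus ?thesis
    using block_state_add[of N "Suc p" P, OF N] M by simp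
qed

section \<open>The unique run\<close>

lemma block_state_succ: "block_state P (add_mset 0 M) = of_bool (M \<in> P)"
  by (subst block_state_add) auto

text \<open>The transitions are deterministic, so \<open>block_state P\<close> is the only run up to
  \<open>omega_pow n\<close>, and its last state records whether \<open>P\<close> is full.\<close>

lemma accepts_full_automaton:
  assumes \<sigma>: "\<sigma> \<in> words {0, 1} (omega_pow n)"
  defines "P \<equiv> {\<alpha>. \<alpha> < omega_pow n \<and> \<sigma> \<alpha> = 1}"
  shows "accepts (full_automaton n) (omega_pow n) \<sigma> \<longleftrightarrow> \<not> full n P"
proof -
  let ?A = "full_automaton n"
  let ?st = "block_state P"
  have sig: "\<sigma> i \<in> {0, 1}" "\<sigma> i = of_bool (i \<in> P)" if "i < omega_pow n" for i
    using \<sigma> that by (auto simp: words_def P_def PiE_iff)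
  have limit: "(Inf_states ?st i, ?st i) \<in> lim_trans ?A"
    if i: "i \<le> omega_pow n" "is_limit i" for i
  proof -
    have "Inf_states ?st i \<subseteq> {..2 * n + 1}"
    proof
      fix q assume "q \<in> Inf_states ?st i"
      moreover have "{#} < i"
        using i(2) by (simp add: is_limit_iff)
      ultimately obtain k where "k < i" "?st k = q"
        unfolding Inf_states_def by blast
      thus "q \<in> {..2 * n + 1}"
        using block_state_bound[of k n P] i(1) by auto
    qed
    thus ?thesis
      using block_state_limit[of i P] block_state_bound[OF i(1), of P] i(2)
      by (auto simp: full_automaton_def is_limit_iff)
  qed
  have run: "is_run ?A (omega_pow n) \<sigma> ?st"
    unfolding is_run_def
  proof (intro conjI allI impI)
    show "?st i \<in> states ?A" if "i \<le> omega_pow n" for i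
      using block_state_bound[OF that, of P] by (simp add: full_automaton_def)
    show "?st bot = init ?A"
      by (simp add: full_automaton_def block_state_def bot_multiset_def)
    show "(?st i, \<sigma> i, ?st j) \<in> succ_trans ?A" if "i < omega_pow n" "is_succ i j" for i j
      using that block_state_bound[of i n P] sig[of i]
      by (auto simp: full_automaton_def is_succ_iff block_state_succ)
  qed (rule limit)
  \<comment> \<open>Transfinite induction: the initial state is fixed, the last letter determines
    the state at a successor, and the earlier states determine it at a limit.\<close>
  have unique: "x i = ?st i" if x: "is_run ?A (omega_pow n) \<sigma> x" and "i \<le> omega_pow n" for x i
    using that(2)
  proof (induction i rule: less_induct)
    case (less i)
    consider "i = {#}" | "0 \<in># i" | "is_limit i"
      by (auto simp: is_limit_iff)
    thus ?case
    proof cases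
      case 1
      thus ?thesis
        using x by (simp add: is_run_def full_automaton_def block_state_def bot_multiset_def)
    next
      case 2
      then obtain j where j: "i = add_mset 0 j"
        by (metis mset_add)
      hence "j < i"
        by simp
      hence "j < omega_pow n"
        using less.prems by (rule less_le_trans)
      hence "(x j, \<sigma> j, x i) \<in> succ_trans ?A"
        using x j by (auto simp: is_run_def is_succ_iff)
      thus ?thesis
        using sig(2)[OF \<open>j < omega_pow n\<close>]
        by (simp add: full_automaton_def j block_state_succ)
    next
      case 3
      have "Inf_states x i = Inf_states ?st i"
        using less.IH less.prems by (intro Inf_states_cong) auto
      moreover have "(Inf_states x i, x i) \<in> lim_trans ?A"
        using x 3 less.prems by (auto simp: is_run_def)
      ultimately show ?thesis
        using limit[OF less.prems 3] by (simp add: full_automaton_def)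
    qed
  qed
  have "accepts ?A (omega_pow n) \<sigma> \<longleftrightarrow> ?st (omega_pow n) \<in> final ?A"
    using run unique unfolding accepts_def by (metis order_refl)
  \<comment> \<open>The block ending at \<open>omega_pow n\<close> starts at \<open>{#}\<close>, so
    it is all of omega^n.\<close>
  also have "?st (omega_pow n) = 2 * n + of_bool (full n P)"
    using block_state_add[of "{#}" n P] by (simp add: omega_pow_def shift_def)
  also have "\<dots> \<in> final ?A \<longleftrightarrow> \<not> full n P"
    by (simp add: full_automaton_def)
  finally show ?thesis .
qed

section \<open>Characteristic words and the accepted language\<close>

lemma char_word_inject:
  assumes "P \<subseteq> {..<omega_pow n}" "Q \<subseteq> {..<omega_pow n}" "char_word n P = char_word n Q"
  shows "P = Q"
proof -
  have "\<alpha> \<in> P \<longleftrightarrow> \<alpha> \<in> Q" if "\<alpha> < omega_pow n" for \<alpha>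
    using fun_cong[OF assms(3), of \<alpha>] that by (simp add: char_word_def split: if_splits)
  thus ?thesis
    using assms(1,2) by blast
qed

lemma char_word_in_words: "char_word n P \<in> words {0, 1} (omega_pow n)"
  by (auto simp: char_word_def words_def)

lemma char_word_support:
  assumes "\<sigma> \<in> words {0, 1} (omega_pow n)"
  shows "char_word n {\<alpha>. \<alpha> < omega_pow n \<and> \<sigma> \<alpha> = 1} = \<sigma>"
proof
  fix \<alpha>
  show "char_word n {\<alpha>. \<alpha> < omega_pow n \<and> \<sigma> \<alpha> = 1} \<alpha> = \<sigma> \<alpha>"
    using assms by (cases "\<alpha> < omega_pow n") (auto simp: char_word_def words_def PiE_iff extensional_def)
qed

theorem theorem4p1:
  fixes n :: nat
  assumes "n \<ge> 1"
  shows "regular_language {0, 1} (omega_pow n) (L_omega n)"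
proof -
  have "\<sigma> \<in> L_omega n \<longleftrightarrow> \<sigma> \<in> language (full_automaton n) (omega_pow n)" for \<sigma>
  proof (cases "\<sigma> \<in> words {0, 1} (omega_pow n)")
    case True
    \<comment> \<open>The support of the word is the only subset of omega^n with this characteristic
      word.\<close>
    define P where "P = {\<alpha>. \<alpha> < omega_pow n \<and> \<sigma> \<alpha> = 1}"
    have P: "P \<subseteq> {..<omega_pow n}" "char_word n P = \<sigma>"
      using char_word_support[OF True] by (auto simp: P_def)
    have "\<sigma> \<in> L_omega n \<longleftrightarrow> P \<in> I_omega n"
    proof
      assume "\<sigma> \<in> L_omega n"
      then obtain Q where "Q \<in> I_omega n" "char_word n Q = char_word n P"
        using P(2) by (auto simp: L_omega_def)
      thus "P \<in> I_omega n"
        using char_word_inject[of Q n P] P(1) by (auto simp: I_omega_def)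
    qed (use P(2) in \<open>auto simp: L_omega_def\<close>)
    also have "\<dots> \<longleftrightarrow> accepts (full_automaton n) (omega_pow n) \<sigma>"
      using I_omega_iff_not_full[OF P(1)] accepts_full_automaton[OF True] by (simp add: P_def)
    finally show ?thesis
      using True by (simp add: language_def full_automaton_def)
  next
    case False
    thus ?thesis
      using char_word_in_words by (auto simp: L_omega_def language_def full_automaton_def)
  qed
  moreover have "ord_buchi_automaton (full_automaton n)"
    by (auto simp: ord_buchi_automaton_def full_automaton_def)
  ultimately show ?thesis
    unfolding regular_language_def
    by (intro exI[of _ "full_automaton n"]) (auto simp: full_automaton_def)
qed

end
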